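(* Let $n,m\ge1$ and let $\hat f,\hat h_1,\dots,\hat h_m:\hat{\mathbb Q}^n\to\hat{\mathbb R}$ be dual quaternion functions. Consider the equality constrained dual quaternion optimization problem $$(\mathrm{EQDQO})\qquad \min\{\hat f(\hat{\mathbf x}):\hat h_j(\hat{\mathbf x})=0,\ j=1,\dots,m\},\qquad \hat{\mathbf x}\in\hat{\mathbb Q}^n .$$ Suppose that $L^{I}$ is the optimal function value of the equality constrained quaternion optimization problem $$\min\{f(\mathbf x,\mathbf x_d): h_j(\mathbf x,\mathbf x_d)=0,\ (h_j)_d(\mathbf x,\mathbf x_d)=0,\ j=1,\dots,m\},$$ and that $(\mathbf x^{opt},\mathbf x_d^{opt})$ is a global optimal solution of the equality constrained quaternion optimization problem $$\min\{f_d(\mathbf x,\mathbf x_d): f(\mathbf x,\mathbf x_d)=L^{I},\ h_j(\mathbf x,\mathbf x_d)=0,\ (h_j)_d(\mathbf x,\mathbf x_d)=0,\ j=1,\dots,m\},$$ where in both problems $(\mathbf x,\mathbf x_d)$ ranges over $\mathbb Q^n\times\mathbb Q^n$. Then $\hat{\mathbf x}^{opt}=\mathbf x^{opt}+\epsilon\mathbf x_d^{opt}$ is a global optimal solution of (EQDQO).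
   Context: Dual numbers: $\hat{\mathbb R}$ is the set of $\hat q=q+q_d\epsilon$ with $q,q_d\in\mathbb R$, where $\epsilon^2=0$; $q$ is the standard part, $q_d$ the dual part. Dual quaternions: $\hat{\mathbb Q}$ is the set of $\hat q=q+q_d\epsilon$ with $q,q_d\in\mathbb Q$, the real quaternions (note: $\mathbb Q$ denotes quaternions here). $\hat{\mathbb Q}^n$ is the set of $n$-dimensional vectors of dual quaternions; write $\hat{\mathbf x}=\mathbf x+\epsilon\mathbf x_d$ with $\mathbf x,\mathbf x_d\in\mathbb Q^n$. Total order on $\hat{\mathbb R}$: $p+p_d\epsilon\le q+q_d\epsilon$ iff $p<q$, or $p=q$ and $p_d\le q_d$. Minimization in (EQDQO) is with respect to this order. A dual quaternion function is a function $\hat f:\hat{\mathbb Q}^n\to\hat{\mathbb R}$. Its standard and dual parts are viewed as real valued functions on $\mathbb Q^n\times\mathbb Q^n$: $\hat f(\mathbf x+\epsilon\mathbf x_d)=f(\mathbf x,\mathbf x_d)+\epsilon f_d(\mathbf x,\mathbf x_d)$, and likewise $\hat h_j(\mathbf x+\epsilon\mathbf x_d)=h_j(\mathbf x,\mathbf x_d)+\epsilon (h_j)_d(\mathbf x,\mathbf x_d)$. *)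

theory Defs
  imports "HOL-Analysis.Analysis" "HOL-Library.Lub_Glb"
begin

section \<open>Real quaternions\<close>

datatype quat = Quat (qre: real) (qim1: real) (qim2: real) (qim3: real)

lemma quat_eq_iff:
  "p = q \<longleftrightarrow> qre p = qre q \<and> qim1 p = qim1 q \<and> qim2 p = qim2 q \<and> qim3 p = qim3 q"
  by (cases p; cases q) simp

instantiation quat :: ring_1
begin

definition "0 = Quat 0 0 0 0"

definition "1 = Quat 1 0 0 0"

definition "p + q = Quat (qre p + qre q) (qim1 p + qim1 q) (qim2 p + qim2 q) (qim3 p + qim3 q)"

definition "- p = Quat (- qre p) (- qim1 p) (- qim2 p) (- qim3 p)"

definition "p - q = Quat (qre p - qre q) (qim1 p - qim1 q) (qim2 p - qim2 q) (qim3 p - qim3 q)"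

text \<open>Hamilton product: \<open>i\<^sup>2 = j\<^sup>2 = k\<^sup>2 = i j k = -1\<close>.\<close>

definition "p * q = Quat
  (qre p * qre q - qim1 p * qim1 q - qim2 p * qim2 q - qim3 p * qim3 q)
  (qre p * qim1 q + qim1 p * qre q + qim2 p * qim3 q - qim3 p * qim2 q)
  (qre p * qim2 q - qim1 p * qim3 q + qim2 p * qre q + qim3 p * qim1 q)
  (qre p * qim3 q + qim1 p * qim2 q - qim2 p * qim1 q + qim3 p * qre q)"

instance
  by standard
    (simp_all add: quat_eq_iff zero_quat_def one_quat_def plus_quat_def uminus_quat_def
      minus_quat_def times_quat_def algebra_simps)

end

section \<open>Dual numbers over a ring\<close>

text \<open>
  \<open>Dual q p\<close> is \<open>q + p \<epsilon>\<close> with a central \<open>\<epsilon>\<close>, \<open>\<epsilon>\<^sup>2 = 0\<close>. Dual real numbers are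
  \<^typ>\<open>real\<close> instances of this type, dual quaternions are \<^typ>\<open>quat\<close> instances.
\<close>

datatype 'a dual_num = Dual (std_part: 'a) (dual_part: 'a)

type_synonym dual_real = "real dual_num"

type_synonym dual_quat = "quat dual_num"

lemma dual_num_eq_iff:
  "p = q \<longleftrightarrow> std_part p = std_part q \<and> dual_part p = dual_part q"
  by (cases p; cases q) simp

instantiation dual_num :: (ring_1) ring_1
begin

definition "0 = Dual 0 0"

definition "1 = Dual 1 0"

definition "p + q = Dual (std_part p + std_part q) (dual_part p + dual_part q)"

definition "- p = Dual (- std_part p) (- dual_part p)"

definition "p - q = Dual (std_part p - std_part q) (dual_part p - dual_part q)"

definition "p * q = Dual (std_part p * std_part q)
  (std_part p * dual_part q + dual_part p * std_part q)"

instance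
  by standard
    (simp_all add: dual_num_eq_iff zero_dual_num_def one_dual_num_def plus_dual_num_def
      uminus_dual_num_def minus_dual_num_def times_dual_num_def algebra_simps)

end

definition eps :: "'a::ring_1 dual_num" where
  "eps = Dual 0 1"

lemma eps_squared: "eps * eps = 0"
  by (simp add: eps_def times_dual_num_def zero_dual_num_def)

lemma Dual_eq_plus_eps: "Dual q p = Dual q 0 + Dual p 0 * eps"
  by (simp add: eps_def times_dual_num_def plus_dual_num_def)

text \<open>The total order on dual numbers is lexicographic, standard part first.\<close>

instantiation dual_num :: (linorder) linorder
begin

definition "p \<le> q \<longleftrightarrow>
  std_part p < std_part q \<or> (std_part p = std_part q \<and> dual_part p \<le> dual_part q)"

definition "p < q \<longleftrightarrow>
  std_part p < std_part q \<or> (std_part p = std_part q \<and> dual_part p < dual_part q)"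

instance
  by standard (auto simp: less_eq_dual_num_def less_dual_num_def dual_num_eq_iff)

end

section \<open>Vectors and functions of dual quaternions\<close>

text \<open>\<open>dual_vec x xd\<close> is the vector \<open>x + \<epsilon> xd\<close>.\<close>

definition dual_vec :: "'a ^ 'n \<Rightarrow> 'a ^ 'n \<Rightarrow> 'a dual_num ^ 'n" where
  "dual_vec x xd = (\<chi> i. Dual (x $ i) (xd $ i))"

lemma dual_vec_eq_plus_eps:
  "dual_vec x xd = (\<chi> i. Dual (x $ i) 0) + eps *s (\<chi> i. Dual (xd $ i) 0)"
  by (simp add: dual_vec_def vec_eq_iff eps_def times_dual_num_def plus_dual_num_def)

text \<open>
  The standard and dual parts of a dual quaternion function, as real valued functions of
  the pair of quaternion vectors \<open>(x, xd)\<close>.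
\<close>

definition std_fun :: "(dual_quat ^ 'n \<Rightarrow> dual_real) \<Rightarrow> (quat ^ 'n) \<times> (quat ^ 'n) \<Rightarrow> real" where
  "std_fun f = (\<lambda>(x, xd). std_part (f (dual_vec x xd)))"

definition dual_fun :: "(dual_quat ^ 'n \<Rightarrow> dual_real) \<Rightarrow> (quat ^ 'n) \<times> (quat ^ 'n) \<Rightarrow> real" where
  "dual_fun f = (\<lambda>(x, xd). dual_part (f (dual_vec x xd)))"

text \<open>
  The optimal value of minimizing \<open>g\<close> subject to \<open>P\<close> is the infimum of \<open>g\<close> over the feasible
  set. It is stated relationally because \<open>Inf\<close> on \<^typ>\<open>real\<close> is unspecified on sets that are
  empty or not bounded below; for such problems no real number is the optimal value.
\<close>

definition is_optimal_value :: "('b \<Rightarrow> real) \<Rightarrow> ('b \<Rightarrow> bool) \<Rightarrow> real \<Rightarrow> bool" where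
  "is_optimal_value g P L \<longleftrightarrow> isGlb UNIV (g ` {z. P z}) L"

end

theory Submission
  imports Defs
begin

text \<open>The order on dual numbers is lexicographic, so minimizing \<open>f\<close> means
  minimizing its standard part first and its dual part among ties. The first problem supplies the
  bound \<open>L\<close> for the standard part; the second one picks a point where \<open>L\<close>
  is attained and the dual part is least. A feasible point with a strictly smaller value would
  contradict one of these two facts. \<open>exists_dual_vec\<close>,
  \<open>dual_fun_eq_zero_iff\<close> and \<open>dual_fun_less_iff\<close> carry points, constraints
  and order over to pairs of quaternion vectors.\<close>

lemma exists_dual_vec: "\<exists>x xd. y = dual_vec x xd"
proof (intro exI)
  show "y = dual_vec (\<chi> i. std_part (y $ i)) (\<chi> i. dual_part (y $ i))"
    by (simp add: dual_vec_def vec_eq_iff)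
qed

lemma dual_fun_eq_zero_iff:
  "f (dual_vec x xd) = 0 \<longleftrightarrow> std_fun f (x, xd) = 0 \<and> dual_fun f (x, xd) = 0"
  by (simp add: std_fun_def dual_fun_def dual_num_eq_iff zero_dual_num_def)

lemma dual_fun_less_iff:
  "f (dual_vec x xd) < f (dual_vec y yd) \<longleftrightarrow>
    std_fun f (x, xd) < std_fun f (y, yd) \<or>
    (std_fun f (x, xd) = std_fun f (y, yd) \<and> dual_fun f (x, xd) < dual_fun f (y, yd))"
  by (simp add: std_fun_def dual_fun_def less_dual_num_def)

text \<open>The infimum enters as a lower bound; its attainment comes from the constraint
  \<open>std_fun f z = L\<close> of the second problem.\<close>

lemma optimal_value_le:
  assumes "is_optimal_value g P L" "P z"
  shows "L \<le> g z"
  using assms by (auto simp: is_optimal_value_def dest!: isGlb_isLb isLbD)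

theorem theorem4p1:
  fixes f :: "dual_quat ^ 'n \<Rightarrow> dual_real"
    and h :: "nat \<Rightarrow> dual_quat ^ 'n \<Rightarrow> dual_real"
    and m :: nat
    and L :: real
    and xopt xdopt :: "quat ^ 'n"
  assumes "1 \<le> m"
    and "is_optimal_value (std_fun f)
           (\<lambda>z. \<forall>j\<in>{1..m}. std_fun (h j) z = 0 \<and> dual_fun (h j) z = 0) L"
    and "is_arg_min (dual_fun f)
           (\<lambda>z. std_fun f z = L \<and>
                (\<forall>j\<in>{1..m}. std_fun (h j) z = 0 \<and> dual_fun (h j) z = 0)) (xopt, xdopt)"
  shows "is_arg_min f (\<lambda>x. \<forall>j\<in>{1..m}. h j x = 0) (dual_vec xopt xdopt)"
proof -
  define P where "P z \<longleftrightarrow> (\<forall>j\<in>{1..m}. std_fun (h j) z = 0 \<and> dual_fun (h j) z = 0)" for z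
  have feasible: "(\<forall>j\<in>{1..m}. h j (dual_vec x xd) = 0) \<longleftrightarrow> P (x, xd)" for x xd
    by (simp add: P_def dual_fun_eq_zero_iff)
  have lower: "L \<le> std_fun f z" if "P z" for z
    using optimal_value_le[OF assms(2)] that by (simp add: P_def)
  have opt: "is_arg_min (dual_fun f) (\<lambda>z. std_fun f z = L \<and> P z) (xopt, xdopt)"
    using assms(3) by (simp add: P_def)
  \<comment> \<open>\<open>is_arg_min\<close> asks that no feasible point have a strictly smaller
    value, so a strict inequality is to be refuted.\<close>
  have "\<not> f y < f (dual_vec xopt xdopt)" if feas: "\<forall>j\<in>{1..m}. h j y = 0" for y
  proof -
    obtain x xd where y: "y = dual_vec x xd"
      using exists_dual_vec by blast
    with feas have "P (x, xd)"
      using feasible by simp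
    \<comment> \<open>The standard part at \<open>(xopt, xdopt)\<close> is \<open>L\<close>. A
      smaller one at \<open>(x, xd)\<close> violates \<open>lower\<close>; an equal one makes
      \<open>(x, xd)\<close> feasible for the second problem, where a smaller dual part violates
      \<open>opt\<close>.\<close>
    with lower[of "(x, xd)"] opt show ?thesis
      by (auto simp: y dual_fun_less_iff is_arg_min_def)
  qed
  moreover have "\<forall>j\<in>{1..m}. h j (dual_vec xopt xdopt) = 0"
    using opt feasible by (simp add: is_arg_min_def)
  ultimately show ?thesis
    by (auto simp: is_arg_min_def)
qed

end
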